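(* Let $(S,+)$ be an abelian semigroup and let $A_0$ and $B_0$ be $\mathbb{N}$-disjoint subsets of $S$. Then there exist $\mathbb{N}$-disjoint convex subsets $A$ and $B$ of $S$ such that $$A_0\subseteq A,\qquad B_0\subseteq B,\qquad\text{and}\qquad A\cup B=S.$$ If, in addition, $S$ is konvex, then $A$ and $B$ are also konvex sets.
   Context: $\mathbb{N}$ denotes the set of positive integers, and an abelian semigroup is a set with a commutative associative operation $+$. For $n\in\mathbb{N}$ and $x\in S$, $nx:=x+\cdots+x$ ($n$ summands). For $A\subseteq S$ and $n\in\mathbb{N}$ put $nA:=\{nx\mid x\in A\}$, $n^{-1}A:=\{x\in S\mid nx\in A\}$, $[n]A:=\{x_1+\cdots+x_n\mid x_1,\ldots,x_n\in A\}$. A set $A\subseteq S$ is $n$-convex if $n^{-1}([n]A)\subseteq A$, and $n$-konvex if $[n]A\subseteq nA$. It is convex (respectively konvex) if it is $n$-convex (respectively $n$-konvex) for all $n\in\mathbb{N}$. Two subsets $A,B$ of $S$ are $\mathbb{N}$-disjoint if $[n]A\cap[n]B=\emptyset$ for all $n\in\mathbb{N}$. *)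

theory Defs
  imports Main
begin

(* A semigroup need not have a zero, so sums are only meaningful for at least one summand.
   "sg_sum x n" is x 1 + ... + x n for n >= 1; it is unspecified for n = 0, and every
   definition below restricts to n >= 1 where it quantifies over n. *)
fun sg_sum :: "(nat \<Rightarrow> 'a::ab_semigroup_add) \<Rightarrow> nat \<Rightarrow> 'a" where
  "sg_sum x (Suc 0) = x 1"
| "sg_sum x (Suc (Suc n)) = sg_sum x (Suc n) + x (Suc (Suc n))"

definition nmult :: "nat \<Rightarrow> 'a::ab_semigroup_add \<Rightarrow> 'a" where
  "nmult n x = sg_sum (\<lambda>_. x) n"

definition set_mult :: "nat \<Rightarrow> 'a::ab_semigroup_add set \<Rightarrow> 'a set" where
  "set_mult n A = {nmult n x | x. x \<in> A}"

definition set_div :: "nat \<Rightarrow> 'a::ab_semigroup_add set \<Rightarrow> 'a set" where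
  "set_div n A = {x. nmult n x \<in> A}"

definition sumset :: "nat \<Rightarrow> 'a::ab_semigroup_add set \<Rightarrow> 'a set" where
  "sumset n A = {sg_sum x n | x. \<forall>i\<in>{1..n}. x i \<in> A}"

definition n_convex :: "nat \<Rightarrow> 'a::ab_semigroup_add set \<Rightarrow> bool" where
  "n_convex n A \<longleftrightarrow> set_div n (sumset n A) \<subseteq> A"

definition n_konvex :: "nat \<Rightarrow> 'a::ab_semigroup_add set \<Rightarrow> bool" where
  "n_konvex n A \<longleftrightarrow> sumset n A \<subseteq> set_mult n A"

definition sg_convex :: "'a::ab_semigroup_add set \<Rightarrow> bool" where
  "sg_convex A \<longleftrightarrow> (\<forall>n\<ge>1. n_convex n A)"

definition sg_konvex :: "'a::ab_semigroup_add set \<Rightarrow> bool" where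
  "sg_konvex A \<longleftrightarrow> (\<forall>n\<ge>1. n_konvex n A)"

definition N_disjoint :: "'a::ab_semigroup_add set \<Rightarrow> 'a set \<Rightarrow> bool" where
  "N_disjoint A B \<longleftrightarrow> (\<forall>n\<ge>1. sumset n A \<inter> sumset n B = {})"

end

theory Submission
  imports Defs
begin

text \<open>
  By Zorn's lemma, enlarge \<open>A0\<close> to a set \<open>A\<close> that is maximal among the sets \<open>\<nat>\<close>-disjoint from
  \<open>B0\<close>, and then \<open>B0\<close> to a set \<open>B\<close> that is maximal among those \<open>\<nat>\<close>-disjoint from \<open>A\<close>. Since
  \<open>B0 \<subseteq> B\<close>, the set \<open>A\<close> is also maximal among those \<open>\<nat>\<close>-disjoint from \<open>B\<close>.

  The point is that such \<open>A\<close> and \<open>B\<close> cover the semigroup. If \<open>x\<close> could be added to neither of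
  them, there would be sums \<open>P\<close> of \<open>p \<ge> 0\<close> elements of \<open>A\<close> and \<open>R\<close> of \<open>r \<ge> 0\<close> elements of \<open>B\<close>
  with \<open>k x + P = Q \<in> [k + p] B\<close> and \<open>l x + R = T \<in> [l + r] A\<close>, where \<open>k, l \<ge> 1\<close>.
  Multiplying by \<open>l\<close> and \<open>k\<close> makes the multiples of \<open>x\<close> equal, so that
  \<open>l Q + k R = l k x + l P + k R = k T + l P\<close>. The left side is a sum of \<open>l (k + p) + k r\<close>
  elements of \<open>B\<close>, the right side one of \<open>k (l + r) + l p\<close> elements of \<open>A\<close>, and these numbers
  agree, contradicting \<open>\<nat>\<close>-disjointness (lemma \<open>N_disjoint_insert\<close>).

  Convexity and konvexity are then immediate: when \<open>n x \<in> [n] A\<close>, the point \<open>x\<close> cannot lie in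
  \<open>B\<close>, since otherwise \<open>n x \<in> [n] A \<inter> [n] B\<close>; so it lies in \<open>A\<close>.
  If the semigroup is konvex, every element of \<open>[n] A\<close> has the form \<open>n x\<close>, and the same
  argument puts \<open>x\<close> in \<open>A\<close>.
\<close>

section \<open>Multiples and sums in a semigroup\<close>

lemma nmult_Suc_0 [simp]: "nmult (Suc 0) x = x"
  by (simp add: nmult_def)

lemma nmult_Suc_Suc [simp]: "nmult (Suc (Suc n)) x = nmult (Suc n) x + x"
  by (simp add: nmult_def)

lemma nmult_add:
  assumes "1 \<le> n"
  shows "nmult n (x + y) = nmult n x + nmult n y"
  using assms
proof (induction n rule: dec_induct)
  case (step n)
  then obtain m where "n = Suc m" by (cases n) auto
  with step show ?case by (simp add: ac_simps)
qed simp

lemma nmult_left_commute: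
  assumes "1 \<le> m" "1 \<le> n"
  shows "nmult m (nmult n x) = nmult n (nmult m x)"
  using assms(1)
proof (induction m rule: dec_induct)
  case (step m)
  then obtain j where "m = Suc j" by (cases m) auto
  with step show ?case by (simp add: nmult_add[OF assms(2)])
qed simp

lemma sg_sum_cong:
  assumes "1 \<le> n" "\<And>i. i \<in> {1..n} \<Longrightarrow> x i = y i"
  shows "sg_sum x n = sg_sum y n"
  using assms
proof (induction n rule: dec_induct)
  case (step n)
  then obtain m where "n = Suc m" by (cases n) auto
  with step show ?case by simp
qed simp

lemma sumset_Suc_0 [simp]: "sumset (Suc 0) A = A"
  by (force simp: sumset_def)

lemma sumset_Suc_Suc:
  "sumset (Suc (Suc n)) A = {y + a | y a. y \<in> sumset (Suc n) A \<and> a \<in> A}"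
proof (intro equalityI subsetI)
  fix z assume "z \<in> sumset (Suc (Suc n)) A"
  then show "z \<in> {y + a | y a. y \<in> sumset (Suc n) A \<and> a \<in> A}"
    by (fastforce simp: sumset_def)
next
  fix z assume "z \<in> {y + a | y a. y \<in> sumset (Suc n) A \<and> a \<in> A}"
  then obtain x a where z: "z = sg_sum x (Suc n) + a" "\<forall>i\<in>{1..Suc n}. x i \<in> A" "a \<in> A"
    by (auto simp: sumset_def)
  let ?x = "x(Suc (Suc n) := a)"
  have "sg_sum ?x (Suc n) = sg_sum x (Suc n)"
    by (rule sg_sum_cong) auto
  with z have "z = sg_sum ?x (Suc (Suc n))" "\<forall>i\<in>{1..Suc (Suc n)}. ?x i \<in> A"
    by auto
  then show "z \<in> sumset (Suc (Suc n)) A"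
    unfolding sumset_def by blast
qed

lemma sumset_mono: "A \<subseteq> B \<Longrightarrow> sumset n A \<subseteq> sumset n B"
  by (auto simp: sumset_def)

lemma nmult_mem_sumset: "x \<in> A \<Longrightarrow> nmult n x \<in> sumset n A"
  by (auto simp: sumset_def nmult_def)

text \<open>A sum has finitely many summands, so it involves only one member of a chain.\<close>

lemma sumset_Union_chain:
  assumes "1 \<le> n" "subset.chain \<A> C" "y \<in> sumset n (\<Union>C)"
  shows "\<exists>A\<in>C. y \<in> sumset n A"
  using assms(1,3)
proof (induction n arbitrary: y rule: dec_induct)
  case (step n)
  then obtain m where n: "n = Suc m" by (cases n) auto
  with step.prems obtain u a where y: "y = u + a" "u \<in> sumset n (\<Union>C)" "a \<in> \<Union>C"
    by (auto simp: sumset_Suc_Suc)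
  with step.IH obtain A A' where "A \<in> C" "u \<in> sumset n A" "A' \<in> C" "a \<in> A'"
    by blast
  moreover from this assms(2) have "A \<subseteq> A' \<or> A' \<subseteq> A"
    by (auto simp: subset_chain_def)
  ultimately show ?case
    using y(1) sumset_mono[of A A' n] by (auto simp: n sumset_Suc_Suc)
qed auto

section \<open>Adding possibly no elements of a set\<close>

text \<open>
  \<open>adds A n u v\<close> expresses \<open>v = u + P\<close> with \<open>P\<close> a sum of \<open>n\<close> elements of \<open>A\<close>. As a relation
  between \<open>u\<close> and \<open>v\<close> it makes sense for \<open>n = 0\<close> although the semigroup has no zero, and so the
  remainders \<open>P\<close> and \<open>R\<close> in the covering argument may be empty.
\<close>

inductive adds :: "'a::ab_semigroup_add set \<Rightarrow> nat \<Rightarrow> 'a \<Rightarrow> 'a \<Rightarrow> bool" for A where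
  adds_0: "adds A 0 u u"
| adds_Suc: "adds A n u v \<Longrightarrow> a \<in> A \<Longrightarrow> adds A (Suc n) u (v + a)"

lemma adds_trans:
  assumes "adds A n v w" "adds A m u v"
  shows "adds A (m + n) u w"
  using assms by induction (auto intro: adds.intros)

lemma adds_add_right: "adds A n u v \<Longrightarrow> adds A n (u + w) (v + w)"
proof (induction rule: adds.induct)
  case (adds_Suc n u v a)
  then have "adds A (Suc n) (u + w) (v + w + a)"
    by (intro adds.adds_Suc)
  then show ?case by (simp add: ac_simps)
qed (rule adds.adds_0)

lemma adds_add_left: "adds A n u v \<Longrightarrow> adds A n (w + u) (w + v)"
  using adds_add_right[of A n u v w] by (simp add: add.commute)

lemma adds_nmult:
  assumes "1 \<le> k" "adds A n u v"
  shows "adds A (k * n) (nmult k u) (nmult k v)"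
  using assms(1)
proof (induction k rule: dec_induct)
  case base
  from assms(2) show ?case by simp
next
  case (step k)
  then obtain j where k: "k = Suc j" by (cases k) auto
  have "adds A (n + k * n) (nmult k u + u) (nmult k v + v)"
    using adds_trans[OF adds_add_right[OF step.IH, of v] adds_add_left[OF assms(2)]] .
  then show ?case by (simp add: k)
qed

text \<open>This is the commutativity of addition: both ways around give \<open>u + P + R\<close>.\<close>

lemma adds_confluent:
  assumes "adds A m u v" "adds B n u w"
  shows "\<exists>z. adds B n v z \<and> adds A m w z"
  using assms
proof (induction rule: adds.induct)
  case (adds_0 u)
  then show ?case by (auto intro: adds.adds_0)
next
  case (adds_Suc m u v a)
  then obtain z where "adds B n v z" "adds A m w z" by blast
  with adds_Suc.hyps(2) have "adds B n (v + a) (z + a)" "adds A (Suc m) w (z + a)"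
    by (auto intro: adds_add_right adds.adds_Suc)
  then show ?case by blast
qed

lemma sumset_adds:
  assumes "adds A n y z" "1 \<le> m" "y \<in> sumset m A"
  shows "z \<in> sumset (m + n) A"
  using assms
proof (induction rule: adds.induct)
  case (adds_Suc n y z a)
  moreover from \<open>1 \<le> m\<close> obtain j where "m = Suc j" by (cases m) auto
  ultimately show ?case by (auto simp: sumset_Suc_Suc)
qed simp

lemma adds_sumset:
  assumes "1 \<le> n" "y \<in> sumset n A"
  shows "adds A n u (u + y)"
  using assms
proof (induction n arbitrary: y rule: dec_induct)
  case base
  then show ?case using adds_Suc[OF adds_0] by simp
next
  case (step n)
  then obtain m where n: "n = Suc m" by (cases n) auto
  with step.prems obtain v a where y: "y = v + a" "v \<in> sumset n A" "a \<in> A"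
    by (auto simp: sumset_Suc_Suc)
  with step.IH have "adds A (Suc n) u (u + v + a)"
    by (intro adds_Suc)
  with y show ?case by (simp add: add.assoc)
qed

lemma nmult_sumset:
  assumes "1 \<le> k" "1 \<le> n" "y \<in> sumset n A"
  shows "nmult k y \<in> sumset (k * n) A"
  using assms(1)
proof (induction k rule: dec_induct)
  case base
  from assms show ?case by simp
next
  case (step k)
  then obtain j where k: "k = Suc j" by (cases k) auto
  have "nmult k y + y \<in> sumset (k * n + n) A"
    using sumset_adds[OF adds_sumset[OF assms(2,3)] _ step.IH] step.hyps assms(2)
    by (simp add: Suc_le_eq)
  then show ?case by (simp add: k add.commute)
qed

text \<open>Collecting the summands equal to \<open>x\<close> leaves a sum of elements of \<open>A\<close>.\<close>

lemma sumset_insert_cases: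
  assumes "1 \<le> n" "y \<in> sumset n (insert x A)"
  shows "y \<in> sumset n A \<or> (\<exists>k j. 1 \<le> k \<and> k + j = n \<and> adds A j (nmult k x) y)"
  using assms
proof (induction n arbitrary: y rule: dec_induct)
  case base
  then consider "y \<in> A" | "y = x" by auto
  then show ?case
  proof cases
    case 2
    then have "adds A 0 (nmult 1 x) y" by (simp add: adds_0)
    then show ?thesis by fastforce
  qed simp
next
  case (step n)
  then obtain m where n: "n = Suc m" by (cases n) auto
  with step.prems obtain u c where
    y: "y = u + c" "u \<in> sumset n (insert x A)" "c \<in> insert x A"
    by (auto simp: sumset_Suc_Suc)
  consider (sum) "u \<in> sumset n A"
    | (adds) k j where "1 \<le> k" "k + j = n" "adds A j (nmult k x) u"
    using step.IH[OF y(2)] by blast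
  then show ?case
  proof cases
    case sum
    show ?thesis
    proof (cases "c \<in> A")
      case True
      with sum y n show ?thesis by (auto simp: sumset_Suc_Suc)
    next
      case False
      with y have "c = x" by simp
      with adds_sumset[OF step.hyps(1) sum, of x] y
      have "adds A n (nmult 1 x) y" by (simp add: add.commute)
      then show ?thesis by (intro disjI2 exI[of _ 1] exI[of _ n]) simp
    qed
  next
    case adds
    show ?thesis
    proof (cases "c \<in> A")
      case True
      with adds y have "adds A (Suc j) (nmult k x) y" by (auto intro: adds_Suc)
      with adds show ?thesis by (intro disjI2 exI[of _ k] exI[of _ "Suc j"]) simp
    next
      case False
      from adds obtain i where "k = Suc i" by (cases k) auto
      with False y adds_add_right[OF adds(3), of x]
      have "adds A j (nmult (Suc k) x) y" by auto
      with adds show ?thesis by (intro disjI2 exI[of _ "Suc k"] exI[of _ j]) simp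
    qed
  qed
qed

section \<open>Maximal disjoint sets\<close>

lemma N_disjoint_sym: "N_disjoint A B \<Longrightarrow> N_disjoint B A"
  by (auto simp: N_disjoint_def)

lemma N_disjoint_mono:
  assumes "N_disjoint A B" "A' \<subseteq> A" "B' \<subseteq> B"
  shows "N_disjoint A' B'"
  using assms sumset_mono[OF assms(2)] sumset_mono[OF assms(3)]
  by (force simp: N_disjoint_def)

lemma not_N_disjoint_insert:
  assumes "N_disjoint A B" "\<not> N_disjoint (insert x A) B"
  obtains k p Q where "1 \<le> k" "adds A p (nmult k x) Q" "Q \<in> sumset (k + p) B"
proof -
  from assms(2) obtain n Q where n: "1 \<le> n" "Q \<in> sumset n (insert x A)" "Q \<in> sumset n B"
    by (auto simp: N_disjoint_def)
  moreover from n assms(1) have "Q \<notin> sumset n A"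
    by (auto simp: N_disjoint_def)
  ultimately show thesis
    using sumset_insert_cases[of n Q x A] that by blast
qed

text \<open>
  Eliminating \<open>x\<close> between two relations that forbid adding it to \<open>A\<close> and to \<open>B\<close>
  yields a common element of \<open>[N] A\<close> and \<open>[N] B\<close>.
\<close>

lemma N_disjoint_insert:
  assumes "N_disjoint A B"
  shows "N_disjoint (insert x A) B \<or> N_disjoint A (insert x B)"
proof (rule ccontr)
  assume contra: "\<not> ?thesis"
  then obtain k p Q where kpQ: "1 \<le> k" "adds A p (nmult k x) Q" "Q \<in> sumset (k + p) B"
    using not_N_disjoint_insert[OF assms] by blast
  from contra have "\<not> N_disjoint (insert x B) A"
    using N_disjoint_sym by blast
  then obtain l r T where lrT: "1 \<le> l" "adds B r (nmult l x) T" "T \<in> sumset (l + r) A"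
    using not_N_disjoint_insert[OF N_disjoint_sym[OF assms]] by blast
  have "adds A (l * p) (nmult l (nmult k x)) (nmult l Q)"
    using kpQ lrT by (intro adds_nmult)
  moreover have "adds B (k * r) (nmult l (nmult k x)) (nmult k T)"
    using adds_nmult[OF kpQ(1) lrT(2)] nmult_left_commute[OF lrT(1) kpQ(1), of x] by (simp only:)
  ultimately obtain z where
    z: "adds B (k * r) (nmult l Q) z" "adds A (l * p) (nmult k T) z"
    using adds_confluent by blast
  have "z \<in> sumset (l * (k + p) + k * r) B"
    by (rule sumset_adds[OF z(1) _ nmult_sumset[OF lrT(1) _ kpQ(3)]])
      (use kpQ(1) lrT(1) in \<open>simp_all add: Suc_le_eq\<close>)
  moreover have "z \<in> sumset (k * (l + r) + l * p) A"
    by (rule sumset_adds[OF z(2) _ nmult_sumset[OF kpQ(1) _ lrT(3)]])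
      (use kpQ(1) lrT(1) in \<open>simp_all add: Suc_le_eq\<close>)
  moreover have "k * (l + r) + l * p = l * (k + p) + k * r"
    by (simp add: algebra_simps)
  moreover have "1 \<le> l * (k + p) + k * r"
    using kpQ(1) lrT(1) by (simp add: Suc_le_eq)
  ultimately show False
    using assms unfolding N_disjoint_def by (metis disjoint_iff)
qed

text \<open>
  For fixed \<open>B\<close>, being \<open>\<nat>\<close>-disjoint from \<open>B\<close> is a property of finite character, which is what
  Zorn's lemma needs.
\<close>

lemma maximal_N_disjoint:
  assumes "N_disjoint A0 B"
  obtains A where "A0 \<subseteq> A" "N_disjoint A B" "\<And>x. N_disjoint (insert x A) B \<Longrightarrow> x \<in> A"
proof -
  let ?D = "{A. A0 \<subseteq> A \<and> N_disjoint A B}"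
  have "\<exists>M\<in>?D. \<forall>X\<in>?D. M \<subseteq> X \<longrightarrow> X = M"
  proof (rule subset_Zorn_nonempty)
    show "?D \<noteq> {}" using assms by blast
  next
    fix C assume C: "C \<noteq> {}" "subset.chain ?D C"
    then have CD: "C \<subseteq> ?D" by (auto simp: subset_chain_def)
    have "N_disjoint (\<Union>C) B"
      unfolding N_disjoint_def
    proof (intro allI impI)
      fix n :: nat assume "1 \<le> n"
      with CD sumset_Union_chain[OF _ C(2)] show "sumset n (\<Union>C) \<inter> sumset n B = {}"
        by (fastforce simp: N_disjoint_def)
    qed
    with C(1) CD show "\<Union>C \<in> ?D" by blast
  qed
  then obtain M where M: "M \<in> ?D" "\<forall>X\<in>?D. M \<subseteq> X \<longrightarrow> X = M"
    by (rule bexE)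
  show thesis
  proof (rule that[of M])
    fix x assume "N_disjoint (insert x M) B"
    with M(1) have "insert x M \<in> ?D" by blast
    with M(2) have "insert x M = M" by (simp add: subset_insertI)
    then show "x \<in> M" by blast
  qed (use M(1) in simp_all)
qed

section \<open>Complementary disjoint sets\<close>

lemma sg_convex_if_complementary:
  assumes "N_disjoint A B" "A \<union> B = UNIV"
  shows "sg_convex A"
  unfolding sg_convex_def n_convex_def set_div_def
proof (intro allI impI subsetI)
  fix n x assume "1 \<le> n" "x \<in> {x. nmult n x \<in> sumset n A}"
  with assms(1) have "x \<notin> B"
    using nmult_mem_sumset by (fastforce simp: N_disjoint_def)
  with assms(2) show "x \<in> A" by blast
qed

lemma sg_konvex_if_complementary:
  fixes A B :: "'a::ab_semigroup_add set"
  assumes "N_disjoint A B" "A \<union> B = UNIV" "sg_konvex (UNIV :: 'a set)"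
  shows "sg_konvex A"
  unfolding sg_konvex_def n_konvex_def
proof (intro allI impI subsetI)
  fix n y assume n: "1 \<le> n" "y \<in> sumset n A"
  then have "y \<in> sumset n UNIV" using sumset_mono by blast
  with n(1) assms(3) obtain x where x: "y = nmult n x"
    by (auto simp: sg_konvex_def n_konvex_def set_mult_def)
  have "x \<in> A"
    using sg_convex_if_complementary[OF assms(1,2)] n x
    by (auto simp: sg_convex_def n_convex_def set_div_def)
  with x show "y \<in> set_mult n A" by (auto simp: set_mult_def)
qed

theorem theorem17:
  fixes A0 B0 :: "'a::ab_semigroup_add set"
  assumes "N_disjoint A0 B0"
  shows "\<exists>A B :: 'a set.
           N_disjoint A B \<and> sg_convex A \<and> sg_convex B \<and>
           A0 \<subseteq> A \<and> B0 \<subseteq> B \<and> A \<union> B = UNIV \<and>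
           (sg_konvex (UNIV :: 'a set) \<longrightarrow> sg_konvex A \<and> sg_konvex B)"
proof -
  obtain A where A: "A0 \<subseteq> A" "N_disjoint A B0" "\<And>x. N_disjoint (insert x A) B0 \<Longrightarrow> x \<in> A"
    using maximal_N_disjoint[OF assms] by blast
  obtain B where B: "B0 \<subseteq> B" "N_disjoint B A" "\<And>x. N_disjoint (insert x B) A \<Longrightarrow> x \<in> B"
    using maximal_N_disjoint[OF N_disjoint_sym[OF A(2)]] by blast
  from B(2) have AB: "N_disjoint A B" by (rule N_disjoint_sym)
  have cover: "A \<union> B = UNIV"
  proof (intro equalityI subsetI)
    fix x
    from N_disjoint_insert[OF AB] show "x \<in> A \<union> B"
    proof
      assume "N_disjoint (insert x A) B"
      with B(1) have "N_disjoint (insert x A) B0"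
        using N_disjoint_mono by blast
      with A(3) show ?thesis by blast
    next
      assume "N_disjoint A (insert x B)"
      with B(3) N_disjoint_sym show ?thesis by blast
    qed
  qed simp
  then have cover': "B \<union> A = UNIV" by blast
  show ?thesis
    using A(1) B(1) AB cover sg_convex_if_complementary[OF AB cover]
      sg_convex_if_complementary[OF B(2) cover'] sg_konvex_if_complementary[OF AB cover]
      sg_konvex_if_complementary[OF B(2) cover']
    by blast
qed

end
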